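(* Suppose that the social choice function $f:\Theta\rightarrow X$ is strongly implementable. Then there exists a payment scheme $P:\Theta\rightarrow\mathbb{Q}^n$ such that the direct revelation mechanism $\Gamma_{(f,P)}$ is incentive compatible and satisfies the selective elimination condition.
   Context: There are $n$ agents $N=\{1,\dots,n\}$ and a finite set $X$ of social choices. Each agent $i$ has a finite type set $\Theta_i$; $\Theta=\Theta_1\times\dots\times\Theta_n$, $\Theta_{-i}=\prod_{j\neq i}\Theta_j$, and $\theta=(\theta_{-i},\theta_i)$. There is a probability distribution $p:\Theta\rightarrow\mathbb{Q}$ ($p\ge0$, $\sum_\theta p(\theta)=1$) with strictly positive marginals $p_i(\theta_i)=\sum_{\theta_{-i}}p(\theta_{-i},\theta_i)$; beliefs are $q_i(\theta_{-i}\mid\theta_i)=p(\theta_{-i},\theta_i)/p_i(\theta_i)$. Each agent has a valuation function $V_i:X\times\Theta\rightarrow\mathbb{Q}$. A social choice function is $f:\Theta\rightarrow X$. A mechanism $\Gamma=(S_1,\dots,S_n,g,P)$ consists of bid sets $S_i$, an outcome function $g:S\rightarrow X$ and payments $P=(P_1,\dots,P_n):S\rightarrow\mathbb{Q}^n$, $S=\prod_i S_i$. A strategy is $\alpha_i:\Theta_i\rightarrow S_i$, a profile is $\alpha=(\alpha_1,\dots,\alpha_n)$, $\alpha(\theta)=(\alpha_i(\theta_i))_i$. Expected utility: $U^\Gamma_i(\alpha_{-i},s_i\mid\theta_i)=\sum_{\theta_{-i}}q_i(\theta_{-i}\mid\theta_i)\big(V_i(g(\alpha_{-i}(\theta_{-i}),s_i),\theta)+P_i(\alpha_{-i}(\theta_{-i}),s_i)\big)$.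 $\alpha$ is an equilibrium if $\alpha_i(\theta_i)$ maximizes $U^\Gamma_i(\alpha_{-i},\cdot\mid\theta_i)$ over $S_i$ for all $i,\theta_i$. $\Gamma$ strongly implements $f$ if it has an equilibrium and every equilibrium $\alpha$ has $g\circ\alpha=f$; $f$ is strongly implementable if some mechanism strongly implements it. The direct revelation mechanism $\Gamma_{(f,P)}$ is $(\Theta_1,\dots,\Theta_n,f,P)$ with $P:\Theta\rightarrow\mathbb{Q}^n$; it is incentive compatible if truthful reporting ($\alpha_i=\mathrm{id}_{\Theta_i}$ for all $i$) is an equilibrium. An equilibrium $\alpha$ of $\Gamma_{(f,P)}$ is bad if $f\circ\alpha\neq f$. An equilibrium $\alpha$ of $\Gamma_{(f,P)}$ can be selectively eliminated if there exist an agent $i$ and functions $h:\Theta_{-i}\rightarrow X$, $\bar P_i:\Theta_{-i}\rightarrow\mathbb{Q}$ such that (1) for some $\bar\theta_i\in\Theta_i$: $\sum_{\theta_{-i}}q_i(\theta_{-i}\mid\bar\theta_i)\big(V_i(h(\alpha_{-i}(\theta_{-i})),\theta_{-i},\bar\theta_i)+\bar P_i(\alpha_{-i}(\theta_{-i}))\big)>\sum_{\theta_{-i}}q_i(\theta_{-i}\mid\bar\theta_i)\big(V_i(f(\alpha_{-i}(\theta_{-i}),\alpha_i(\bar\theta_i)),\theta_{-i},\bar\theta_i)+P_i(\alpha_{-i}(\theta_{-i}),\alpha_i(\bar\theta_i))\big)$, and (2) for all $\theta_i\in\Theta_i$: $\sum_{\theta_{-i}}q_i(\theta_{-i}\mid\theta_i)\big(V_i(f(\theta),\theta)+P_i(\theta)-V_i(h(\theta_{-i}),\theta)-\bar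 P_i(\theta_{-i})\big)\ge0$. $\Gamma_{(f,P)}$ satisfies the selective elimination condition if every bad equilibrium of it can be selectively eliminated. *)

theory Defs
  imports Complex_Main "HOL-Library.FuncSet"
begin

text \<open>
  Agents are the numbers 1, ..., n. A profile (one type or one bid per agent) is a function on
  agent indices which is \<^const>\<open>undefined\<close> outside its index set, so that the product of the
  sets \<open>A i\<close> is \<open>PiE\<close>; a profile with agent \<open>i\<close> left out is indexed by the agents other than \<open>i\<close>,
  and \<open>\<tau>(i := t)\<close> completes it. All other functions are total HOL functions whose values outside
  the intended domain are irrelevant: they are only constrained, evaluated and compared on it.
  The types \<open>'t\<close>, \<open>'s\<close>, \<open>'x\<close> serve as universes containing the type sets, bid sets and choices.
\<close>

type_synonym 'a profile = "nat \<Rightarrow> 'a"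

type_synonym ('t, 's) strategies = "nat \<Rightarrow> 't \<Rightarrow> 's"

record ('t, 'x) environment =
  num_agents :: nat
  choices :: "'x set"
  type_set :: "nat \<Rightarrow> 't set"
  prior :: "'t profile \<Rightarrow> rat"
  valuation :: "nat \<Rightarrow> 'x \<Rightarrow> 't profile \<Rightarrow> rat"

definition agents :: "('t, 'x) environment \<Rightarrow> nat set" where
  "agents E = {1..num_agents E}"

definition type_profiles :: "('t, 'x) environment \<Rightarrow> 't profile set" where
  "type_profiles E = PiE (agents E) (type_set E)"

definition type_profiles_except :: "('t, 'x) environment \<Rightarrow> nat \<Rightarrow> 't profile set" where
  "type_profiles_except E i = PiE (agents E - {i}) (type_set E)"

definition marginal :: "('t, 'x) environment \<Rightarrow> nat \<Rightarrow> 't \<Rightarrow> rat" where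
  "marginal E i t = (\<Sum>\<tau>\<in>type_profiles_except E i. prior E (\<tau>(i := t)))"

definition belief :: "('t, 'x) environment \<Rightarrow> nat \<Rightarrow> 't profile \<Rightarrow> 't \<Rightarrow> rat" where
  "belief E i \<tau> t = prior E (\<tau>(i := t)) / marginal E i t"

definition wf_environment :: "('t, 'x) environment \<Rightarrow> bool" where
  "wf_environment E \<longleftrightarrow>
     finite (choices E) \<and>
     (\<forall>i\<in>agents E. finite (type_set E i)) \<and>
     (\<forall>\<theta>\<in>type_profiles E. 0 \<le> prior E \<theta>) \<and>
     (\<Sum>\<theta>\<in>type_profiles E. prior E \<theta>) = 1 \<and>
     (\<forall>i\<in>agents E. \<forall>t\<in>type_set E i. 0 < marginal E i t)"

definition social_choice_function :: "('t, 'x) environment \<Rightarrow> ('t profile \<Rightarrow> 'x) \<Rightarrow> bool" where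
  "social_choice_function E f \<longleftrightarrow> f \<in> type_profiles E \<rightarrow> choices E"

record ('s, 'x) mechanism =
  bids :: "nat \<Rightarrow> 's set"
  outcome :: "'s profile \<Rightarrow> 'x"
  payment :: "nat \<Rightarrow> 's profile \<Rightarrow> rat"

definition wf_mechanism :: "('t, 'x) environment \<Rightarrow> ('s, 'x) mechanism \<Rightarrow> bool" where
  "wf_mechanism E \<Gamma> \<longleftrightarrow> outcome \<Gamma> \<in> PiE (agents E) (bids \<Gamma>) \<rightarrow> choices E"

definition strategy_profile ::
  "('t, 'x) environment \<Rightarrow> ('s, 'x) mechanism \<Rightarrow> ('t, 's) strategies \<Rightarrow> bool" where
  "strategy_profile E \<Gamma> \<alpha> \<longleftrightarrow> (\<forall>i\<in>agents E. \<alpha> i \<in> type_set E i \<rightarrow> bids \<Gamma> i)"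

definition play ::
  "('t, 'x) environment \<Rightarrow> ('t, 's) strategies \<Rightarrow> 't profile \<Rightarrow> 's profile" where
  "play E \<alpha> \<theta> = (\<lambda>j\<in>agents E. \<alpha> j (\<theta> j))"

definition play_except ::
  "('t, 'x) environment \<Rightarrow> nat \<Rightarrow> ('t, 's) strategies \<Rightarrow> 't profile \<Rightarrow> 's profile" where
  "play_except E i \<alpha> \<tau> = (\<lambda>j\<in>agents E - {i}. \<alpha> j (\<tau> j))"

text \<open>
  \<open>expected_utility E \<Gamma> i \<alpha> s t\<close> is the utility of agent \<open>i\<close> of type \<open>t\<close> bidding \<open>s\<close> while the
  others follow \<open>\<alpha>\<close>; the component \<open>\<alpha> i\<close> is not used.
\<close>

definition expected_utility ::
  "('t, 'x) environment \<Rightarrow> ('s, 'x) mechanism \<Rightarrow> nat \<Rightarrow> ('t, 's) strategies \<Rightarrow> 's \<Rightarrow> 't \<Rightarrow> rat"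
where
  "expected_utility E \<Gamma> i \<alpha> s t =
     (\<Sum>\<tau>\<in>type_profiles_except E i. belief E i \<tau> t *
        (valuation E i (outcome \<Gamma> ((play_except E i \<alpha> \<tau>)(i := s))) (\<tau>(i := t))
         + payment \<Gamma> i ((play_except E i \<alpha> \<tau>)(i := s))))"

definition equilibrium ::
  "('t, 'x) environment \<Rightarrow> ('s, 'x) mechanism \<Rightarrow> ('t, 's) strategies \<Rightarrow> bool" where
  "equilibrium E \<Gamma> \<alpha> \<longleftrightarrow>
     strategy_profile E \<Gamma> \<alpha> \<and>
     (\<forall>i\<in>agents E. \<forall>t\<in>type_set E i. \<forall>s\<in>bids \<Gamma> i.
        expected_utility E \<Gamma> i \<alpha> s t \<le> expected_utility E \<Gamma> i \<alpha> (\<alpha> i t) t)"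

definition strongly_implements ::
  "('t, 'x) environment \<Rightarrow> ('s, 'x) mechanism \<Rightarrow> ('t profile \<Rightarrow> 'x) \<Rightarrow> bool" where
  "strongly_implements E \<Gamma> f \<longleftrightarrow>
     (\<exists>\<alpha>. equilibrium E \<Gamma> \<alpha>) \<and>
     (\<forall>\<alpha>. equilibrium E \<Gamma> \<alpha> \<longrightarrow>
        (\<forall>\<theta>\<in>type_profiles E. outcome \<Gamma> (play E \<alpha> \<theta>) = f \<theta>))"

text \<open>
  The bid sets of a mechanism are arbitrary. HOL cannot quantify existentially over the universe
  \<open>'s\<close> of bids, so it is passed as a type argument; in a theorem assuming
  \<open>strongly_implementable TYPE('s) E f\<close> with \<open>'s\<close> a type variable not occurring in the conclusion,
  the implicit universal quantification over \<open>'s\<close> amounts to an existential one in the assumption.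
\<close>

definition strongly_implementable ::
  "'s itself \<Rightarrow> ('t, 'x) environment \<Rightarrow> ('t profile \<Rightarrow> 'x) \<Rightarrow> bool" where
  "strongly_implementable (_ :: 's itself) E f \<longleftrightarrow>
     (\<exists>\<Gamma> :: ('s, 'x) mechanism. wf_mechanism E \<Gamma> \<and> strongly_implements E \<Gamma> f)"

definition direct_mechanism ::
  "('t, 'x) environment \<Rightarrow> ('t profile \<Rightarrow> 'x) \<Rightarrow> (nat \<Rightarrow> 't profile \<Rightarrow> rat) \<Rightarrow> ('t, 'x) mechanism"
where
  "direct_mechanism E f P = \<lparr>bids = type_set E, outcome = f, payment = P\<rparr>"

definition incentive_compatible ::
  "('t, 'x) environment \<Rightarrow> ('t profile \<Rightarrow> 'x) \<Rightarrow> (nat \<Rightarrow> 't profile \<Rightarrow> rat) \<Rightarrow> bool" where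
  "incentive_compatible E f P \<longleftrightarrow> equilibrium E (direct_mechanism E f P) (\<lambda>i. id)"

definition bad_equilibrium ::
  "('t, 'x) environment \<Rightarrow> ('t profile \<Rightarrow> 'x) \<Rightarrow> (nat \<Rightarrow> 't profile \<Rightarrow> rat) \<Rightarrow>
   ('t, 't) strategies \<Rightarrow> bool" where
  "bad_equilibrium E f P \<alpha> \<longleftrightarrow>
     equilibrium E (direct_mechanism E f P) \<alpha> \<and>
     (\<exists>\<theta>\<in>type_profiles E. f (play E \<alpha> \<theta>) \<noteq> f \<theta>)"

definition selectively_eliminable ::
  "('t, 'x) environment \<Rightarrow> ('t profile \<Rightarrow> 'x) \<Rightarrow> (nat \<Rightarrow> 't profile \<Rightarrow> rat) \<Rightarrow>
   ('t, 't) strategies \<Rightarrow> bool" where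
  "selectively_eliminable E f P \<alpha> \<longleftrightarrow>
     (\<exists>i\<in>agents E. \<exists>h Pbar. h \<in> type_profiles_except E i \<rightarrow> choices E \<and>
        (\<exists>t\<in>type_set E i.
           (\<Sum>\<tau>\<in>type_profiles_except E i. belief E i \<tau> t *
              (valuation E i (h (play_except E i \<alpha> \<tau>)) (\<tau>(i := t))
               + Pbar (play_except E i \<alpha> \<tau>)))
           > (\<Sum>\<tau>\<in>type_profiles_except E i. belief E i \<tau> t *
                (valuation E i (f ((play_except E i \<alpha> \<tau>)(i := \<alpha> i t))) (\<tau>(i := t))
                 + P i ((play_except E i \<alpha> \<tau>)(i := \<alpha> i t))))) \<and>
        (\<forall>t\<in>type_set E i.
           (\<Sum>\<tau>\<in>type_profiles_except E i. belief E i \<tau> t *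
              (valuation E i (f (\<tau>(i := t))) (\<tau>(i := t)) + P i (\<tau>(i := t))
               - valuation E i (h \<tau>) (\<tau>(i := t)) - Pbar \<tau>)) \<ge> 0))"

definition selective_elimination_condition ::
  "('t, 'x) environment \<Rightarrow> ('t profile \<Rightarrow> 'x) \<Rightarrow> (nat \<Rightarrow> 't profile \<Rightarrow> rat) \<Rightarrow> bool" where
  "selective_elimination_condition E f P \<longleftrightarrow>
     (\<forall>\<alpha>. bad_equilibrium E f P \<alpha> \<longrightarrow> selectively_eliminable E f P \<alpha>)"

end

(* Let \<beta> be an equilibrium of a mechanism \<Gamma> strongly implementing f, and let P be the payments
   of \<Gamma> under \<beta>. By the revelation principle truth-telling is an equilibrium of the direct mechanism.
   If \<alpha> is a bad equilibrium of it, then the composition \<beta> o \<alpha> yields the outcome f o \<alpha> \<noteq> f in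
   \<Gamma>, so it is not an equilibrium of \<Gamma>: some agent i has a profitable deviation to a bid s. Offering
   i the outcome and payment of the bid s against \<beta> eliminates \<alpha> selectively; condition (2) holds
   because s is not a profitable deviation from \<beta> itself. *)

theory Submission
  imports Defs
begin

lemma play_fun_upd:
  assumes "i \<in> agents E"
  shows "play E \<beta> (\<tau>(i := t)) = (play_except E i \<beta> \<tau>)(i := \<beta> i t)"
  using assms by (auto simp: play_def play_except_def fun_eq_iff)

text \<open>Composing strategies agentwise matches composing plays. This lets reports made under
  \<open>\<alpha>\<close> be fed into \<open>\<beta>\<close>, and so turns strategies of the direct
  mechanism into strategies of \<open>\<Gamma>\<close>.\<close>

lemma play_comp: "play E (\<lambda>j. \<beta> j \<circ> \<alpha> j) \<theta> = play E \<beta> (play E \<alpha> \<theta>)"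
  by (auto simp: play_def fun_eq_iff)

lemma play_except_comp:
  "play_except E i (\<lambda>j. \<beta> j \<circ> \<alpha> j) \<tau> = play_except E i \<beta> (play_except E i \<alpha> \<tau>)"
  by (auto simp: play_except_def fun_eq_iff)

lemma fun_upd_in_type_profiles:
  assumes "\<tau> \<in> type_profiles_except E i" "i \<in> agents E" "t \<in> type_set E i"
  shows "\<tau>(i := t) \<in> type_profiles E"
  using assms by (auto simp: type_profiles_except_def type_profiles_def PiE_def Pi_def extensional_def)

lemma strategy_profile_direct_mechanism:
  "strategy_profile E (direct_mechanism E f P) \<alpha> \<longleftrightarrow>
     (\<forall>i\<in>agents E. \<alpha> i \<in> type_set E i \<rightarrow> type_set E i)"
  by (simp add: strategy_profile_def direct_mechanism_def)

lemma play_in_type_profiles: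
  assumes "strategy_profile E (direct_mechanism E f P) \<alpha>" "\<theta> \<in> type_profiles E"
  shows "play E \<alpha> \<theta> \<in> type_profiles E"
  using assms
  by (fastforce simp: strategy_profile_direct_mechanism play_def type_profiles_def)

lemma play_except_in_type_profiles_except:
  assumes "strategy_profile E (direct_mechanism E f P) \<alpha>" "\<tau> \<in> type_profiles_except E i"
  shows "play_except E i \<alpha> \<tau> \<in> type_profiles_except E i"
  using assms
  by (fastforce simp: strategy_profile_direct_mechanism play_except_def type_profiles_except_def)

lemma strategy_profile_comp:
  assumes "strategy_profile E (direct_mechanism E f P) \<alpha>" "strategy_profile E \<Gamma> \<beta>"
  shows "strategy_profile E \<Gamma> (\<lambda>j. \<beta> j \<circ> \<alpha> j)"
  using assms by (simp add: strategy_profile_def direct_mechanism_def Pi_def)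

text \<open>The direct mechanism simulates \<open>\<Gamma>\<close>: reports are translated into bids
  by \<open>\<beta>\<close>, so others reporting by \<open>\<alpha>\<close> bid by
  \<open>\<beta>\<close> after \<open>\<alpha>\<close>, and the report \<open>r\<close> becomes the
  bid \<open>\<beta> i r\<close>. The summands agree one by one.\<close>

lemma expected_utility_direct_mechanism:
  assumes "strategy_profile E (direct_mechanism E f P) \<alpha>"
    and "\<And>\<theta>. \<theta> \<in> type_profiles E \<Longrightarrow> outcome \<Gamma> (play E \<beta> \<theta>) = f \<theta>"
    and "P = (\<lambda>i \<theta>. payment \<Gamma> i (play E \<beta> \<theta>))"
    and "i \<in> agents E" "r \<in> type_set E i"
  shows "expected_utility E (direct_mechanism E f P) i \<alpha> r t
       = expected_utility E \<Gamma> i (\<lambda>j. \<beta> j \<circ> \<alpha> j) (\<beta> i r) t"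
  unfolding expected_utility_def
proof (rule sum.cong[OF refl])
  fix \<tau> assume "\<tau> \<in> type_profiles_except E i"
  \<comment> \<open>Outcomes under \<open>\<beta>\<close> are known to equal \<open>f\<close> only
    at type profiles, so the reported profile has to be one.\<close>
  then have "(play_except E i \<alpha> \<tau>)(i := r) \<in> type_profiles E"
    using assms by (intro fun_upd_in_type_profiles play_except_in_type_profiles_except)
  from assms(2)[OF this]
  show "belief E i \<tau> t *
      (valuation E i (outcome (direct_mechanism E f P) ((play_except E i \<alpha> \<tau>)(i := r))) (\<tau>(i := t))
       + payment (direct_mechanism E f P) i ((play_except E i \<alpha> \<tau>)(i := r)))
    = belief E i \<tau> t *
      (valuation E i (outcome \<Gamma> ((play_except E i (\<lambda>j. \<beta> j \<circ> \<alpha> j) \<tau>)(i := \<beta> i r))) (\<tau>(i := t))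
       + payment \<Gamma> i ((play_except E i (\<lambda>j. \<beta> j \<circ> \<alpha> j) \<tau>)(i := \<beta> i r)))"
    using assms(3,4) by (simp add: direct_mechanism_def play_except_comp play_fun_upd)
qed

text \<open>Revelation principle: a misreport \<open>r\<close> amounts to the bid
  \<open>\<beta> i r\<close>, one of the deviations that the equilibrium \<open>\<beta>\<close>
  already makes unprofitable.\<close>

lemma incentive_compatible_if_equilibrium:
  assumes "equilibrium E \<Gamma> \<beta>"
    and "\<And>\<theta>. \<theta> \<in> type_profiles E \<Longrightarrow> outcome \<Gamma> (play E \<beta> \<theta>) = f \<theta>"
    and "P = (\<lambda>i \<theta>. payment \<Gamma> i (play E \<beta> \<theta>))"
  shows "incentive_compatible E f P"
proof -
  have truth: "strategy_profile E (direct_mechanism E f P) (\<lambda>j. id)"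
    by (simp add: strategy_profile_direct_mechanism)
  have "expected_utility E (direct_mechanism E f P) i (\<lambda>j. id) r t
      = expected_utility E \<Gamma> i \<beta> (\<beta> i r) t"
    if "i \<in> agents E" "r \<in> type_set E i" for i r t
    using expected_utility_direct_mechanism[OF truth assms(2,3) that] by simp
  then show ?thesis
    using assms(1) truth
    by (fastforce simp: incentive_compatible_def equilibrium_def strategy_profile_def
        direct_mechanism_def)
qed

lemma selectively_eliminable_if_bad:
  assumes "wf_mechanism E \<Gamma>"
    and implements: "strongly_implements E \<Gamma> f"
    and equilibrium: "equilibrium E \<Gamma> \<beta>"
    and P: "P = (\<lambda>i \<theta>. payment \<Gamma> i (play E \<beta> \<theta>))"
    and bad: "bad_equilibrium E f P \<alpha>"
  shows "selectively_eliminable E f P \<alpha>"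
proof -
  let ?\<gamma> = "\<lambda>j. \<beta> j \<circ> \<alpha> j"
  have out: "outcome \<Gamma> (play E \<beta> \<theta>) = f \<theta>" if "\<theta> \<in> type_profiles E" for \<theta>
    using implements equilibrium that by (auto simp: strongly_implements_def)
  have \<alpha>: "strategy_profile E (direct_mechanism E f P) \<alpha>"
    using bad by (simp add: bad_equilibrium_def equilibrium_def)
  have \<beta>: "strategy_profile E \<Gamma> \<beta>"
    using equilibrium by (simp add: equilibrium_def)
  obtain \<theta> where \<theta>: "\<theta> \<in> type_profiles E" "f (play E \<alpha> \<theta>) \<noteq> f \<theta>"
    using bad by (auto simp: bad_equilibrium_def)
  have "outcome \<Gamma> (play E ?\<gamma> \<theta>) \<noteq> f \<theta>"
    using \<theta> out[OF play_in_type_profiles[OF \<alpha> \<theta>(1)]] by (simp add: play_comp)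
  then have "\<not> equilibrium E \<Gamma> ?\<gamma>"
    using implements \<theta>(1) by (auto simp: strongly_implements_def)
  \<comment> \<open>As \<open>?\<gamma>\<close> is a strategy profile, it can fail to be an
    equilibrium only through a profitable deviation.\<close>
  then obtain i t s where i: "i \<in> agents E" and t: "t \<in> type_set E i" and s: "s \<in> bids \<Gamma> i"
    and less: "expected_utility E \<Gamma> i ?\<gamma> (?\<gamma> i t) t < expected_utility E \<Gamma> i ?\<gamma> s t"
    using strategy_profile_comp[OF \<alpha> \<beta>] by (auto simp: equilibrium_def not_le)
  \<comment> \<open>The bid \<open>s\<close> may lie outside the range of \<open>\<beta> i\<close>,
    so this offer need not correspond to any report of agent \<open>i\<close>.\<close>
  define h where "h \<tau> = outcome \<Gamma> ((play_except E i \<beta> \<tau>)(i := s))" for \<tau>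
  define Pbar where "Pbar \<tau> = payment \<Gamma> i ((play_except E i \<beta> \<tau>)(i := s))" for \<tau>
  have "h \<tau> \<in> choices E" if "\<tau> \<in> type_profiles_except E i" for \<tau>
  proof -
    have "(play_except E i \<beta> \<tau>)(i := s) \<in> PiE (agents E) (bids \<Gamma>)"
      using that \<beta> i s
      by (fastforce simp: play_except_def type_profiles_except_def strategy_profile_def
          PiE_def Pi_def extensional_def)
    then show ?thesis
      using assms(1) by (auto simp: h_def wf_mechanism_def)
  qed
  then have h: "h \<in> type_profiles_except E i \<rightarrow> choices E"
    by blast
  have "\<alpha> i t \<in> type_set E i"
    using \<alpha> i t by (auto simp: strategy_profile_direct_mechanism)
  from expected_utility_direct_mechanism[OF \<alpha> out P i this]
  have "expected_utility E (direct_mechanism E f P) i \<alpha> (\<alpha> i t) t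
      < expected_utility E \<Gamma> i ?\<gamma> s t"
    using less by simp
  \<comment> \<open>At the reports \<open>play_except E i \<alpha> \<tau>\<close> the offer is
    exactly the result of bidding \<open>s\<close> against \<open>?\<gamma>\<close>.\<close>
  then have 1: "(\<Sum>\<tau>\<in>type_profiles_except E i. belief E i \<tau> t *
        (valuation E i (h (play_except E i \<alpha> \<tau>)) (\<tau>(i := t)) + Pbar (play_except E i \<alpha> \<tau>)))
      > (\<Sum>\<tau>\<in>type_profiles_except E i. belief E i \<tau> t *
        (valuation E i (f ((play_except E i \<alpha> \<tau>)(i := \<alpha> i t))) (\<tau>(i := t))
         + P i ((play_except E i \<alpha> \<tau>)(i := \<alpha> i t))))"
    by (simp add: expected_utility_def direct_mechanism_def play_except_comp h_def Pbar_def)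
  \<comment> \<open>At truthful reports the offer is the result of bidding \<open>s\<close> against
    \<open>\<beta>\<close>, so the sum is the loss from deviating from \<open>\<beta> i r\<close> to
    \<open>s\<close>.\<close>
  have 2: "(\<Sum>\<tau>\<in>type_profiles_except E i. belief E i \<tau> r *
        (valuation E i (f (\<tau>(i := r))) (\<tau>(i := r)) + P i (\<tau>(i := r))
         - valuation E i (h \<tau>) (\<tau>(i := r)) - Pbar \<tau>)) \<ge> 0"
    if r: "r \<in> type_set E i" for r
  proof -
    have "f (\<tau>(i := r)) = outcome \<Gamma> ((play_except E i \<beta> \<tau>)(i := \<beta> i r))"
      if "\<tau> \<in> type_profiles_except E i" for \<tau>
      using out[OF fun_upd_in_type_profiles[OF that i r]] by (simp add: play_fun_upd[OF i])
    then have "(\<Sum>\<tau>\<in>type_profiles_except E i. belief E i \<tau> r *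
        (valuation E i (f (\<tau>(i := r))) (\<tau>(i := r)) + P i (\<tau>(i := r))
         - valuation E i (h \<tau>) (\<tau>(i := r)) - Pbar \<tau>))
      = expected_utility E \<Gamma> i \<beta> (\<beta> i r) r - expected_utility E \<Gamma> i \<beta> s r"
      unfolding expected_utility_def sum_subtractf[symmetric]
      by (intro sum.cong) (simp_all add: P play_fun_upd[OF i] h_def Pbar_def algebra_simps)
    then show ?thesis
      using equilibrium i r s by (simp add: equilibrium_def)
  qed
  show ?thesis
    unfolding selectively_eliminable_def using i h t 1 2 by blast
qed

theorem theorem2:
  fixes E :: "('t, 'x) environment"
    and f :: "'t profile \<Rightarrow> 'x"
  assumes "wf_environment E"
    and "social_choice_function E f"
    and "strongly_implementable TYPE('s) E f"
  shows "\<exists>P :: nat \<Rightarrow> 't profile \<Rightarrow> rat.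
           incentive_compatible E f P \<and> selective_elimination_condition E f P"
proof -
  obtain \<Gamma> :: "('s, 'x) mechanism" where \<Gamma>: "wf_mechanism E \<Gamma>" "strongly_implements E \<Gamma> f"
    using assms(3) by (auto simp: strongly_implementable_def)
  then obtain \<beta> where \<beta>: "equilibrium E \<Gamma> \<beta>"
    by (auto simp: strongly_implements_def)
  have "outcome \<Gamma> (play E \<beta> \<theta>) = f \<theta>" if "\<theta> \<in> type_profiles E" for \<theta>
    using \<Gamma>(2) \<beta> that by (auto simp: strongly_implements_def)
  \<comment> \<open>Both uses of \<open>refl\<close> fix \<open>P\<close> as the payments under
    \<open>\<beta>\<close>. Since \<open>\<beta>\<close> is chosen before any bad equilibrium, one
    \<open>P\<close> serves for all of them.\<close>
  then show ?thesis
    using incentive_compatible_if_equilibrium[OF \<beta> _ refl]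
      selectively_eliminable_if_bad[OF \<Gamma> \<beta> refl]
    unfolding selective_elimination_condition_def by blast
qed

end
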